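(* There exists a measurable function $\mu$ on $\mathbb{C}$ with $|\mu|\leqslant\chi_{\mathbb{D}}$ such that \[ \sigma^2(\mathcal{S}\mu) := \frac{1}{2\pi}\limsup_{R\to1^+}\, \frac{1}{|\log(R-1)|} \int_{0}^{2 \pi} |\mathcal{S} \mu (Re^{i \theta})|^2 \, d\theta > 0.87913. \]
   Context: $\mathbb{D}$ is the open unit disk and $\chi_{\mathbb{D}}$ its indicator function. The Beurling transform is $\mathcal{S}\mu(z)=-\frac{1}{\pi}\,\mathrm{p.v.}\int_{\mathbb{C}}\frac{\mu(w)}{(z-w)^2}\,dm(w)$, with $m$ Lebesgue measure; for $\mu$ supported in $\overline{\mathbb{D}}$ it is holomorphic on $\{|z|>1\}$. *)

theory Defs
  imports "HOL-Analysis.Analysis"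
begin

definition beurling :: "(complex \<Rightarrow> complex) \<Rightarrow> complex \<Rightarrow> complex" where
  "beurling \<mu> z = Lim (at_right 0)
     (\<lambda>\<epsilon>::real. - (1 / complex_of_real pi) *
        (LINT w : {w. dist w z > \<epsilon>} | lebesgue. \<mu> w / (z - w)\<^sup>2))"

definition asymp_var :: "(complex \<Rightarrow> complex) \<Rightarrow> ereal" where
  "asymp_var f = ereal (1 / (2 * pi)) *
     Limsup (at_right (1::real))
       (\<lambda>R. ereal (1 / \<bar>ln (R - 1)\<bar> *
          (LINT \<theta> : {0..2*pi} | lborel. (cmod (f (complex_of_real R * cis \<theta>)))\<^sup>2)))"

end

theory Submission
  imports Defs "HOL-Real_Asymp.Real_Asymp"
begin

text \<open>
  Fix an integer $d \ge 3$ and $0 < \beta < 1$, and cut the annulus $\beta \le |w| < 1$ at the radii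
  $r_n = \beta^{1/d^n}$. On $r_n \le |w| < r_{n+1}$ let $\mu(w) = (\bar w/|w|)^{N-2}$ with
  $N = d^{n+1}$. Expanding $(z-w)^{-2}$ in powers of $w/z$ gives a series for $\mathcal{S}\mu$ in
  powers of $1/z$; by rotation invariance only the annulus number $n$ contributes to the coefficient
  of $z^{-N}$, which is $-2(1-1/N)(r_{n+1}^N - r_n^N) = -2(1-1/N)(\beta - \beta^d)$.
  By Parseval the circle mean of $|\mathcal{S}\mu|^2$ at radius close to $1 + d^{-k}$ is then about
  $4k(\beta-\beta^d)^2$, so that $\sigma^2(\mathcal{S}\mu) \ge 4(\beta-\beta^d)^2/\log d$.
  The best integer is $d = 20$, and $\beta$ should be close to $d^{-1/(d-1)}$, the maximum of
  $\beta - \beta^d$.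
\<close>

section \<open>Rotation invariance and moments on annuli\<close>

text \<open>Identifies the plane with \<open>real^2\<close>, where orthogonal maps are known to
  preserve measure. Agreement on open boxes determines \<open>lborel\<close>, and a box pulls back
  to the box with the same side lengths.\<close>

lemma lborel_complex_eq_distr_real2:
  "(lborel :: complex measure) = distr (lborel :: (real^2) measure) borel (\<lambda>v. Complex (v $ 1) (v $ 2))"
proof (rule lborel_eqI)
  have [measurable]: "(\<lambda>v::real^2. Complex (v $ 1) (v $ 2)) \<in> borel_measurable borel"
    by (intro borel_measurable_continuous_onI) (auto simp: Complex_eq intro!: continuous_intros)
  fix l u :: complex assume le: "\<And>b. b \<in> Basis \<Longrightarrow> l \<bullet> b \<le> u \<bullet> b"
  have "(\<lambda>v::real^2. Complex (v $ 1) (v $ 2)) -` box l u = box (vector [Re l, Im l]) (vector [Re u, Im u])"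
    by (auto simp: box_def Basis_complex_def Basis_vec_def inner_axis forall_2 cart_eq_inner_axis[symmetric])
  moreover have "emeasure lborel (box (vector [Re l, Im l] :: real^2) (vector [Re u, Im u]))
      = (Re u - Re l) * (Im u - Im l)"
    using le[of 1] le[of \<i>]
    by (subst emeasure_lborel_box)
       (auto simp: Basis_complex_def Basis_vec_def inner_axis forall_2 UNIV_2 axis_eq_axis cart_eq_inner_axis[symmetric])
  ultimately show "emeasure (distr lborel borel (\<lambda>v::real^2. Complex (v $ 1) (v $ 2))) (box l u)
      = ennreal (\<Prod>b\<in>Basis. (u - l) \<bullet> b)"
    by (subst emeasure_distr) (auto simp: Basis_complex_def)
qed simp

text \<open>The preimage of a box under \<open>f\<close> is its image under the inverse
  \<open>g\<close>, which is again orthogonal and so preserves the measure of the box.\<close>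

lemma lborel_distr_orthogonal_transformation:
  fixes f :: "real^'n::{finite,wellorder} \<Rightarrow> real^'n::_"
  assumes f: "orthogonal_transformation f"
  shows "distr lborel borel f = lborel"
proof (rule lborel_eqI[symmetric])
  obtain g where g: "orthogonal_transformation g" and gf: "\<And>x. g (f x) = x" "\<And>x. f (g x) = x"
    using orthogonal_transformation_inv[OF f] orthogonal_transformation_bij[OF f]
    by (metis bij_inv_eq_iff)
  have [measurable]: "f \<in> borel_measurable borel"
    using f by (intro borel_measurable_continuous_onI)
      (simp add: linear_continuous_on linear_conv_bounded_linear[symmetric] orthogonal_transformation_linear)
  fix l u :: "(real, 'n) vec" assume le: "\<And>b. b \<in> Basis \<Longrightarrow> l \<bullet> b \<le> u \<bullet> b"
  have eq: "f -` box l u = g ` box l u"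
    using gf by (auto simp: image_iff) metis+
  have "f -` box l u \<in> sets borel"
    by (rule measurable_sets_borel[of f borel]) auto
  then have "emeasure lborel (f -` box l u) = emeasure lebesgue (g ` box l u)"
    by (simp add: eq)
  also have "\<dots> = measure lebesgue (g ` box l u)"
    by (intro emeasure_eq_measure2 measurable_orthogonal_image g) auto
  also have "\<dots> = measure lborel (box l u)"
    by (subst measure_orthogonal_image[OF g]) auto
  finally show "emeasure (distr lborel borel f) (box l u) = ennreal (\<Prod>b\<in>Basis. (u - l) \<bullet> b)"
    using le by (subst emeasure_distr) (auto simp: measure_lborel_box_eq)
qed simp

text \<open>The identification \<open>T\<close> carries multiplication by \<open>c\<close> over to
  the real-linear map \<open>F\<close>; it preserves norms because |c| = 1, hence is orthogonal on
  \<open>real^2\<close>.\<close>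

lemma lborel_distr_mult_unit_complex:
  fixes c :: complex
  assumes c: "cmod c = 1"
  shows "distr lborel borel ((*) c) = lborel"
proof -
  define T where "T = (\<lambda>v::real^2. Complex (v $ 1) (v $ 2))"
  define F where "F = (\<lambda>v::real^2. vector [Re (c * T v), Im (c * T v)] :: real^2)"
  have [measurable]: "T \<in> borel_measurable borel" unfolding T_def
    by (intro borel_measurable_continuous_onI) (auto simp: Complex_eq intro!: continuous_intros)
  have lin: "linear F"
    by (intro linearI) (auto simp: F_def T_def vec_eq_iff forall_2 algebra_simps)
  have norm_T: "norm v = cmod (T v)" for v :: "real^2"
    by (simp add: T_def norm_vec_def L2_set_def UNIV_2 cmod_def)
  have TF: "T (F v) = c * T v" for v
    by (simp add: T_def F_def complex_eq_iff)
  have orth: "orthogonal_transformation F"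
    unfolding orthogonal_transformation using lin by (simp add: norm_T TF norm_mult c)
  have [measurable]: "F \<in> borel_measurable borel"
    using lin by (intro borel_measurable_continuous_onI)
      (simp add: linear_continuous_on linear_conv_bounded_linear[symmetric])
  have "distr lborel borel ((*) c) = distr (distr lborel borel T) borel ((*) c)"
    using lborel_complex_eq_distr_real2 by (simp add: T_def)
  also have "\<dots> = distr lborel borel (T \<circ> F)"
    by (subst distr_distr) (auto simp: o_def TF)
  also have "\<dots> = distr (distr lborel borel F) borel T"
    by (subst distr_distr) auto
  also have "\<dots> = lborel"
    using lborel_complex_eq_distr_real2
    by (simp add: lborel_distr_orthogonal_transformation[OF orth] T_def)
  finally show ?thesis .
qed

lemma integral_lborel_mult_unit_complex:
  fixes f :: "complex \<Rightarrow> 'b::{banach, second_countable_topology}"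
  assumes "cmod c = 1" and [measurable]: "f \<in> borel_measurable borel"
  shows "(LINT w|lborel. f (c * w)) = (LINT w|lborel. f w)"
proof -
  have "(LINT w|lborel. f w) = (LINT w|distr lborel borel ((*) c). f w)"
    using lborel_distr_mult_unit_complex[OF assms(1)] by simp
  also have "\<dots> = (LINT w|lborel. f (c * w))"
    by (subst integral_distr) auto
  finally show ?thesis ..
qed

section \<open>Integrals of powers of |w| over disks and annuli\<close>

lemma emeasure_complex_ball:
  assumes "r \<ge> 0"
  shows "emeasure lborel (ball (z::complex) r) = ennreal (pi * r\<^sup>2)"
  using assms by (simp add: emeasure_ball unit_ball_vol_2)

text \<open>Layer cake: $|w|^{m+1} = \int_0^{|w|} (m+1) t^m\,dt$, and Tonelli.\<close>

lemma has_bochner_integral_cmod_power_ball: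
  assumes b: "b \<ge> 0"
  shows "has_bochner_integral lborel (\<lambda>w::complex. indicator (ball 0 b) w * cmod w ^ Suc m)
           (2 * pi * b ^ (m + 3) / (m + 3))"
proof -
  have "(\<integral>\<^sup>+w. ennreal (indicator (ball 0 b) w * cmod w ^ Suc m) \<partial>lborel)
      = (\<integral>\<^sup>+(w::complex). (\<integral>\<^sup>+t. ennreal (Suc m * t ^ m) * indicator {0..cmod w} t \<partial>lborel) * indicator (ball 0 b) w \<partial>lborel)"
  proof (intro nn_integral_cong)
    fix w :: complex
    have "(\<integral>\<^sup>+t. ennreal (Suc m * t ^ m) * indicator {0..cmod w} t \<partial>lborel) = cmod w ^ Suc m - 0 ^ Suc m"
      by (intro nn_integral_FTC_Icc) (use DERIV_pow[of "Suc m"] in auto)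
    then show "ennreal (indicator (ball 0 b) w * cmod w ^ Suc m)
        = (\<integral>\<^sup>+t. ennreal (Suc m * t ^ m) * indicator {0..cmod w} t \<partial>lborel) * indicator (ball 0 b) w"
      by (auto split: split_indicator)
  qed
  \<comment> \<open>The region 0 \<le> t \<le> |w| < b is read as t in [0, b] with w in
    \<open>ball 0 b - ball 0 t\<close>; after the exchange the inner integral is just the area of
    that set.\<close>
  also have "\<dots> = (\<integral>\<^sup>+(w::complex). (\<integral>\<^sup>+t. ennreal (Suc m * t ^ m) * indicator {0..b} t * indicator (ball 0 b - ball 0 t) w \<partial>lborel) \<partial>lborel)"
    by (subst nn_integral_multc[symmetric])
       (auto intro!: nn_integral_cong split: split_indicator)
  also have "\<dots> = (\<integral>\<^sup>+t. (\<integral>\<^sup>+(w::complex). ennreal (Suc m * t ^ m) * indicator {0..b} t * indicator (ball 0 b - ball 0 t) w \<partial>lborel) \<partial>lborel)"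
    by (rule lborel_pair.Fubini') (auto simp: indicator_def[abs_def] case_prod_unfold)
  also have "\<dots> = (\<integral>\<^sup>+t. ennreal (Suc m * t ^ m * (pi * b\<^sup>2 - pi * t\<^sup>2)) * indicator {0..b} t \<partial>lborel)"
  proof (intro nn_integral_cong)
    fix t :: real
    show "(\<integral>\<^sup>+(w::complex). ennreal (Suc m * t ^ m) * indicator {0..b} t * indicator (ball 0 b - ball 0 t) w \<partial>lborel)
        = ennreal (Suc m * t ^ m * (pi * b\<^sup>2 - pi * t\<^sup>2)) * indicator {0..b} t"
    proof (cases "t \<in> {0..b}")
      case True
      then have "emeasure lborel (ball (0::complex) b - ball 0 t) = ennreal (pi * b\<^sup>2 - pi * t\<^sup>2)"
        by (subst emeasure_Diff) (auto simp: emeasure_complex_ball ennreal_minus)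
      with True show ?thesis
        by (subst nn_integral_cmult_indicator) (auto simp: ennreal_mult power_mono)
    qed simp
  qed
  also have "\<dots> = ennreal ((pi * b\<^sup>2 * b ^ Suc m - pi * Suc m * b ^ (m + 3) / (m + 3))
        - (pi * b\<^sup>2 * 0 ^ Suc m - pi * Suc m * 0 ^ (m + 3) / (m + 3)))"
  proof (rule nn_integral_FTC_Icc[where F = "\<lambda>t. pi * b\<^sup>2 * t ^ Suc m - pi * Suc m * t ^ (m + 3) / (m + 3)"])
    fix t assume t: "t \<in> {0..b}"
    show "((\<lambda>t. pi * b\<^sup>2 * t ^ Suc m - pi * Suc m * t ^ (m + 3) / (m + 3)) has_real_derivative
            Suc m * t ^ m * (pi * b\<^sup>2 - pi * t\<^sup>2)) (at t)"
      by (rule derivative_eq_intros refl | simp)+ (simp add: field_simps power_add eval_nat_numeral)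
    show "0 \<le> Suc m * t ^ m * (pi * b\<^sup>2 - pi * t\<^sup>2)"
      using t by (simp add: power_mono)
  qed (use b in auto)
  also have "(pi * b\<^sup>2 * b ^ Suc m - pi * Suc m * b ^ (m + 3) / (m + 3))
        - (pi * b\<^sup>2 * 0 ^ Suc m - pi * Suc m * 0 ^ (m + 3) / (m + 3)) = 2 * pi * b ^ (m + 3) / (m + 3)"
    by (simp add: field_simps power_add eval_nat_numeral)
  finally show ?thesis
    using b by (intro has_bochner_integral_nn_integral) (measurable, auto)
qed

lemma cnj_borel_measurable [measurable]: "cnj \<in> borel_measurable borel"
  by (intro borel_measurable_continuous_onI continuous_intros)

lemma complex_of_real_borel_measurable [measurable]: "complex_of_real \<in> borel_measurable borel"
  by (intro borel_measurable_continuous_onI continuous_intros)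

lemma has_bochner_integral_indicator_unit_disk:
  "has_bochner_integral lborel (indicator (ball (0::complex) 1)) pi"
  using has_bochner_integral_real_indicator[of "ball (0::complex) 1" lborel]
  by (simp add: emeasure_complex_ball measure_def)

text \<open>For \<open>p = q\<close> the integrand is |w|^q, and the integral is a difference of two
  disk integrals. For \<open>p \<noteq> q\<close> a suitable rotation changes the sign of the
  integrand, so the integral equals its own negative.\<close>

lemma annulus_moment:
  fixes a b :: real
  assumes ab: "0 \<le> a" "a \<le> b" and q: "q > 0"
  shows "(LINT w:{w. a \<le> cmod w \<and> cmod w < b}|lborel. (cnj w / cmod w) ^ p * w ^ q)
      = (if p = q then of_real (2 * pi * (b ^ (q + 2) - a ^ (q + 2)) / (q + 2)) else 0)"
proof (cases "p = q")
  case True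
  obtain m where m: "q = Suc m" using q gr0_conv_Suc by blast
  have "has_bochner_integral lborel
      (\<lambda>w::complex. of_real (indicator (ball 0 b) w * cmod w ^ q - indicator (ball 0 a) w * cmod w ^ q) :: complex)
      (of_real (2 * pi * b ^ (m + 3) / (m + 3) - 2 * pi * a ^ (m + 3) / (m + 3)))"
    unfolding m using ab
    by (intro has_bochner_integral_of_real has_bochner_integral_diff has_bochner_integral_cmod_power_ball) auto
  moreover have "of_real (indicator (ball 0 b) w * cmod w ^ q - indicator (ball 0 a) w * cmod w ^ q)
      = indicator {w. a \<le> cmod w \<and> cmod w < b} w *\<^sub>R ((cnj w / cmod w) ^ p * w ^ q)" for w :: complex
  proof -
    have "(cnj w / cmod w) ^ p * w ^ q = of_real (cmod w ^ q)"
    proof (cases "w = 0")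
      case False
      have "cnj w / cmod w * w = cmod w"
        using False complex_norm_square[of w] by (simp add: field_simps power2_eq_square)
      then show ?thesis using True by (simp flip: power_mult_distrib)
    qed (use q in auto)
    then show ?thesis using ab by (auto split: split_indicator)
  qed
  ultimately show ?thesis
    using True unfolding set_lebesgue_integral_def
    by (simp add: has_bochner_integral_integral_eq m diff_divide_distrib right_diff_distrib add_ac eval_nat_numeral)
next
  case False
  \<comment> \<open>The rotation multiplies the integrand by a phase of angle (q - p) arg c; this
    choice makes the angle pi, whichever of p and q is larger.\<close>
  define c where "c = cis (pi / (real q - real p))"
  define f where "f = (\<lambda>w. indicator {w. a \<le> cmod w \<and> cmod w < b} w *\<^sub>R ((cnj w / cmod w) ^ p * w ^ q))"
  have c1: "cmod c = 1" by (simp add: c_def)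
  have "(cnj c) ^ p * c ^ q = cis (real q * (pi / (real q - real p)) - real p * (pi / (real q - real p)))"
    by (simp add: c_def cis_cnj Complex.DeMoivre cis_mult)
  also have "real q * (pi / (real q - real p)) - real p * (pi / (real q - real p)) = pi"
    using False by (simp flip: left_diff_distrib diff_divide_distrib)
  finally have c2: "(cnj c) ^ p * c ^ q = -1" by simp
  have "f (c * w) = - f w" for w
  proof -
    have "f (c * w) = ((cnj c) ^ p * c ^ q) * f w"
      by (simp add: f_def norm_mult c1 power_mult_distrib power_divide indicator_def)
    then show ?thesis by (simp add: c2)
  qed
  moreover have [measurable]: "f \<in> borel_measurable borel"
    unfolding f_def by measurable
  ultimately have "- (LINT w|lborel. f w) = (LINT w|lborel. f w)"
    using integral_lborel_mult_unit_complex[OF c1, of f] by simp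
  then have "(LINT w|lborel. f w) = 0" by (simp add: eq_neg_iff_add_eq_0)
  then show ?thesis using False by (simp add: set_lebesgue_integral_def f_def)
qed

section \<open>Parseval's inequality\<close>

lemma has_bochner_integral_cis_int:
  "has_bochner_integral lborel (\<lambda>t. indicator {0..2*pi} t *\<^sub>R cis (of_int m * t))
     (if m = 0 then of_real (2 * pi) else 0)"
proof (cases "m = 0")
  case True
  have "has_bochner_integral lborel (\<lambda>t. indicator {0..2*pi} t *\<^sub>R (1::complex)) (of_real (2*pi) - of_real 0)"
    by (intro has_bochner_integral_FTC_Icc) (auto intro!: derivative_eq_intros)
  with True show ?thesis by simp
next
  case False
  have "has_bochner_integral lborel (\<lambda>t. indicator {0..2*pi} t *\<^sub>R cis (of_int m * t))
     (cis (of_int m * (2*pi)) / (\<i> * of_int m) - cis (of_int m * 0) / (\<i> * of_int m))"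
  proof (intro has_bochner_integral_FTC_Icc)
    fix t :: real
    show "((\<lambda>t. cis (of_int m * t) / (\<i> * of_int m)) has_vector_derivative cis (of_int m * t)) (at t within {0..2*pi})"
      using False unfolding cis_conv_exp
      by (auto intro!: derivative_eq_intros has_vector_derivative_real_field simp: field_simps)
  qed (auto intro!: continuous_intros)
  moreover have "cis (of_int m * (2*pi)) = 1"
    using cis_multiple_2pi[of "of_int m"] by (simp add: mult_ac)
  ultimately show ?thesis using False by simp
qed

text \<open>Expand the square as the sum times its conjugate; injectivity of \<open>k\<close> leaves
  frequency 0 only on the diagonal.\<close>

lemma parseval_finite:
  fixes a :: "nat \<Rightarrow> complex" and k :: "nat \<Rightarrow> int"
  assumes k: "inj k"
  shows "has_bochner_integral lborel
     (\<lambda>t. indicator {0..2*pi} t *\<^sub>R (cmod (\<Sum>j<J. a j * cis (of_int (k j) * t)))\<^sup>2)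
     (2 * pi * (\<Sum>j<J. (cmod (a j))\<^sup>2))"
proof -
  have "has_bochner_integral lborel
     (\<lambda>t. \<Sum>i<J. \<Sum>j<J. (a i * cnj (a j)) * (indicator {0..2*pi} t *\<^sub>R cis (of_int (k i - k j) * t)))
     (\<Sum>i<J. \<Sum>j<J. (a i * cnj (a j)) * (if k i - k j = 0 then of_real (2 * pi) else 0))"
    by (intro has_bochner_integral_sum has_bochner_integral_mult_right has_bochner_integral_cis_int)
  also have "(\<Sum>i<J. \<Sum>j<J. (a i * cnj (a j)) * (if k i - k j = 0 then of_real (2 * pi) else 0))
      = (\<Sum>i<J. \<Sum>j<J. if i = j then (a i * cnj (a j)) * of_real (2 * pi) else 0)"
    using k by (intro sum.cong refl) (auto simp: inj_eq)
  also have "\<dots> = (\<Sum>i<J. (a i * cnj (a i)) * of_real (2 * pi))"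
    by simp
  also have "\<dots> = of_real (2 * pi * (\<Sum>j<J. (cmod (a j))\<^sup>2))"
    by (simp only: complex_norm_square[symmetric]) (simp add: sum_distrib_left mult_ac)
  also have "(\<lambda>t. \<Sum>i<J. \<Sum>j<J. (a i * cnj (a j)) * (indicator {0..2*pi} t *\<^sub>R cis (of_int (k i - k j) * t)))
     = (\<lambda>t. of_real (indicator {0..2*pi} t *\<^sub>R (cmod (\<Sum>j<J. a j * cis (of_int (k j) * t)))\<^sup>2))"
  proof
    fix t
    have cis: "cis (of_int (k i - k j) * t) = cis (of_int (k i) * t) * cnj (cis (of_int (k j) * t))" for i j
      by (simp add: cis_cnj cis_mult left_diff_distrib)
    have "of_real ((cmod (\<Sum>j<J. a j * cis (of_int (k j) * t)))\<^sup>2)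
       = (\<Sum>j<J. a j * cis (of_int (k j) * t)) * cnj (\<Sum>j<J. a j * cis (of_int (k j) * t))"
      by (rule complex_norm_square)
    also have "\<dots> = (\<Sum>i<J. \<Sum>j<J. (a i * cnj (a j)) * cis (of_int (k i - k j) * t))"
      by (simp only: sum_product cis cnj_sum complex_cnj_mult) (simp only: mult_ac)
    finally show "(\<Sum>i<J. \<Sum>j<J. (a i * cnj (a j)) * (indicator {0..2*pi} t *\<^sub>R cis (of_int (k i - k j) * t)))
       = of_real (indicator {0..2*pi} t *\<^sub>R (cmod (\<Sum>j<J. a j * cis (of_int (k j) * t)))\<^sup>2)"
      by (cases "t \<in> {0..2*pi}") (simp_all del: of_int_diff)
  qed
  \<comment> \<open>The identity so far is between complex numbers that are real; the claim is its
    real part.\<close>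
  finally show ?thesis
    using has_bochner_integral_Re by fastforce
qed

text \<open>Finite Parseval passes to the limit by dominated convergence, since all partial sums are
  bounded by \<open>C\<close>. An arbitrary finite \<open>F\<close> is allowed because later only
  the lacunary frequencies are kept.\<close>

lemma parseval_sum_le:
  fixes a :: "nat \<Rightarrow> complex" and k :: "nat \<Rightarrow> int"
  assumes k: "inj k" and a: "summable (\<lambda>j. cmod (a j))" and "finite F"
  shows "2 * pi * (\<Sum>j\<in>F. (cmod (a j))\<^sup>2) \<le>
    (LINT t:{0..2*pi}|lborel. (cmod (\<Sum>j. a j * cis (of_int (k j) * t)))\<^sup>2)"
proof -
  define S where "S = (\<lambda>J t. (\<Sum>j<J. a j * cis (of_int (k j) * t)))"
  define C where "C = (\<Sum>j. cmod (a j))"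
  have sm: "summable (\<lambda>j. a j * cis (of_int (k j) * t))" for t
    by (rule summable_norm_cancel) (use a in \<open>simp add: norm_mult\<close>)
  have [measurable]: "S J \<in> borel_measurable borel" for J
    unfolding S_def by (intro borel_measurable_continuous_onI continuous_intros)
  have Slim: "(\<lambda>J. S J t) \<longlonglongrightarrow> (\<Sum>j. a j * cis (of_int (k j) * t))" for t
    unfolding S_def using sm by (rule summable_LIMSEQ)
  have bd: "cmod (S J t) \<le> C" for J t
  proof -
    have "cmod (S J t) \<le> (\<Sum>j<J. cmod (a j))"
      unfolding S_def by (rule order_trans[OF norm_sum]) (simp add: norm_mult)
    also have "\<dots> \<le> C" unfolding C_def using a by (intro sum_le_suminf) auto
    finally show ?thesis .
  qed
  have "(\<lambda>J. LINT t:{0..2*pi}|lborel. (cmod (S J t))\<^sup>2) \<longlonglongrightarrow>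
     (LINT t:{0..2*pi}|lborel. (cmod (\<Sum>j. a j * cis (of_int (k j) * t)))\<^sup>2)"
    unfolding set_lebesgue_integral_def
  proof (rule integral_dominated_convergence[where w = "\<lambda>t. indicator {0..2*pi} t * C\<^sup>2"])
    have [measurable]: "(\<lambda>t. \<Sum>j. a j * cis (of_int (k j) * t)) \<in> borel_measurable borel"
      by (rule borel_measurable_LIMSEQ_metric[OF _ Slim]) measurable
    show "(\<lambda>t. indicat_real {0..2*pi} t *\<^sub>R (cmod (\<Sum>j. a j * cis (of_int (k j) * t)))\<^sup>2) \<in> borel_measurable lborel"
      by measurable
    show "AE t in lborel. (\<lambda>J. indicat_real {0..2*pi} t *\<^sub>R (cmod (S J t))\<^sup>2)
      \<longlonglongrightarrow> indicat_real {0..2*pi} t *\<^sub>R (cmod (\<Sum>j. a j * cis (of_int (k j) * t)))\<^sup>2"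
      by (intro AE_I2 tendsto_intros Slim)
    show "AE t in lborel. norm (indicat_real {0..2*pi} t *\<^sub>R (cmod (S J t))\<^sup>2) \<le> indicat_real {0..2*pi} t * C\<^sup>2" for J
      using bd[of J] by (auto split: split_indicator intro!: power_mono)
  qed auto
  moreover have "(LINT t:{0..2*pi}|lborel. (cmod (S J t))\<^sup>2) = 2 * pi * (\<Sum>j<J. (cmod (a j))\<^sup>2)" for J
    using has_bochner_integral_integral_eq[OF parseval_finite[OF k, of a J]]
    by (simp add: S_def set_lebesgue_integral_def)
  ultimately have lim: "(\<lambda>J. 2 * pi * (\<Sum>j<J. (cmod (a j))\<^sup>2)) \<longlonglongrightarrow>
     (LINT t:{0..2*pi}|lborel. (cmod (\<Sum>j. a j * cis (of_int (k j) * t)))\<^sup>2)" by simp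
  obtain J0 where J0: "F \<subseteq> {..<J0}"
    using \<open>finite F\<close> by (meson finite_nat_iff_bounded)
  \<comment> \<open>From \<open>J0\<close> on, the partial sums contain all terms with index in
    \<open>F\<close>, and the remaining terms are nonnegative.\<close>
  show ?thesis
    by (rule LIMSEQ_le_const[OF lim])
       (use J0 in \<open>auto intro!: exI[of _ J0] mult_left_mono sum_mono2\<close>)
qed

section \<open>The expansion of the Beurling transform at infinity\<close>

text \<open>The coefficient of z^-(j+2) in the expansion at infinity, from (z - w)^-2 = sum of (j+1)
  w^j / z^(j+2) for |w| < |z|.\<close>

definition beurling_coeff :: "(complex \<Rightarrow> complex) \<Rightarrow> nat \<Rightarrow> complex" where
  "beurling_coeff \<mu> j = - of_real (real (Suc j) / pi) * (LINT w|lborel. \<mu> w * w ^ j)"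

context
  fixes \<mu> :: "complex \<Rightarrow> complex"
  assumes \<mu>_meas [measurable]: "\<mu> \<in> borel_measurable borel"
    and \<mu>_le: "\<And>w. cmod (\<mu> w) \<le> indicator (ball 0 1) w"
begin

lemma \<mu>_power_le: "cmod (\<mu> w * w ^ j) \<le> indicator (ball 0 1) w"
  using \<mu>_le[of w] mult_mono[OF \<mu>_le[of w], of "cmod w ^ j" 1]
  by (auto simp: norm_mult norm_power power_le_one split: split_indicator_asm split_indicator)

lemma integrable_\<mu>_power: "integrable lborel (\<lambda>w. \<mu> w * w ^ j)"
  using \<mu>_power_le
  by (intro Bochner_Integration.integrable_bound[OF integrable.intros[OF has_bochner_integral_indicator_unit_disk]]) auto

lemma integral_norm_\<mu>_power_le: "(LINT w|lborel. cmod (\<mu> w * w ^ j)) \<le> pi"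
proof -
  have "(LINT w|lborel. cmod (\<mu> w * w ^ j)) \<le> (LINT w|lborel. indicator (ball (0::complex) 1) w)"
    using \<mu>_power_le integrable_\<mu>_power integrable.intros[OF has_bochner_integral_indicator_unit_disk]
    by (intro integral_mono integrable_norm) auto
  also have "\<dots> = pi"
    using has_bochner_integral_integral_eq[OF has_bochner_integral_indicator_unit_disk] .
  finally show ?thesis .
qed

text \<open>Each moment is at most the area pi of the disk. Linear growth of the coefficients is
  enough for absolute convergence on every circle of radius \<open>R > 1\<close>.\<close>

lemma norm_beurling_coeff_le: "cmod (beurling_coeff \<mu> j) \<le> real (Suc j)"
proof -
  have "cmod (LINT w|lborel. \<mu> w * w ^ j) \<le> pi"
    using integral_norm_bound[of lborel "\<lambda>w. \<mu> w * w ^ j"] integral_norm_\<mu>_power_le[of j] by linarith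
  then have "real (Suc j) / pi * cmod (LINT w|lborel. \<mu> w * w ^ j) \<le> real (Suc j) / pi * pi"
    by (intro mult_left_mono) auto
  then show ?thesis by (simp add: beurling_coeff_def norm_mult norm_divide del: of_nat_Suc)
qed

lemma summable_beurling_coeff:
  assumes "R > 1"
  shows "summable (\<lambda>j. cmod (beurling_coeff \<mu> j / of_real (R ^ (j + 2))))"
proof (rule summable_comparison_test')
  have "(\<lambda>j. real (Suc j) * (1 / R) ^ j) sums (1 / (1 - 1 / R)\<^sup>2)"
    using assms by (intro geometric_deriv_sums) (simp add: divide_less_eq)
  then show "summable (\<lambda>j. real (Suc j) * (1 / R) ^ j * (1 / R\<^sup>2))"
    by (intro summable_mult2) (rule sums_summable)
  show "norm (cmod (beurling_coeff \<mu> j / of_real (R ^ (j + 2)))) \<le> real (Suc j) * (1 / R) ^ j * (1 / R\<^sup>2)" for j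
    using norm_beurling_coeff_le[of j] assms
    by (simp add: norm_divide norm_power power_divide power_add norm_mult divide_right_mono power2_eq_square mult_ac)
qed

text \<open>No principal value is needed outside the closed disk: once \<epsilon> < |z| - 1, the
  removed disk around z misses the unit disk, so the truncated integral is constant in
  \<epsilon>.\<close>

lemma beurling_eq_integral:
  assumes z: "cmod z > 1"
  shows "beurling \<mu> z = - (1 / of_real pi) * (LINT w|lborel. \<mu> w / (z - w)\<^sup>2)"
  unfolding beurling_def
proof (rule tendsto_Lim)
  have "eventually (\<lambda>\<epsilon>. \<epsilon> < cmod z - 1) (at_right 0)"
    using z by (intro eventually_at_rightI[of 0 "cmod z - 1"]) auto
  then have "\<forall>\<^sub>F \<epsilon> in at_right 0. - (1 / complex_of_real pi) *
        (LINT w : {w. dist w z > \<epsilon>} | lebesgue. \<mu> w / (z - w)\<^sup>2)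
      = - (1 / of_real pi) * (LINT w|lborel. \<mu> w / (z - w)\<^sup>2)"
  proof eventually_elim
    case (elim \<epsilon>)
    have "indicat_real {w. dist w z > \<epsilon>} w *\<^sub>R (\<mu> w / (z - w)\<^sup>2) = \<mu> w / (z - w)\<^sup>2" for w
    proof (cases "cmod w < 1")
      case True
      have "cmod z - cmod w \<le> dist w z"
        by (metis dist_commute dist_norm norm_triangle_ineq2)
      with True elim show ?thesis by simp
    next
      case False
      then show ?thesis using \<mu>_le[of w] by simp
    qed
    \<comment> \<open>The integrand is Borel, so \<open>integral_completion\<close> passes from
      \<open>lebesgue\<close> to \<open>lborel\<close>.\<close>
    then show ?case
      by (simp add: set_lebesgue_integral_def integral_completion)
  qed
  then show "((\<lambda>\<epsilon>. - (1 / complex_of_real pi) * (LINT w : {w. dist w z > \<epsilon>} | lebesgue. \<mu> w / (z - w)\<^sup>2))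
      \<longlongrightarrow> - (1 / of_real pi) * (LINT w|lborel. \<mu> w / (z - w)\<^sup>2)) (at_right 0)"
    by (rule tendsto_eventually)
qed simp

text \<open>Termwise integration of the differentiated geometric series in w/z. The exchange is
  justified because the L1 norm of term j is at most pi (j+1) / |z|^(j+2), which is
  summable.\<close>

lemma beurling_sums:
  assumes z: "cmod z > 1"
  shows "(\<lambda>j. beurling_coeff \<mu> j / z ^ (j + 2)) sums beurling \<mu> z"
proof -
  have z0: "z \<noteq> 0" using z by auto
  define f where "f = (\<lambda>j w. (of_nat (Suc j) / z ^ (j + 2)) * (\<mu> w * w ^ j))"
  have f_sums: "(\<lambda>j. f j w) sums (\<mu> w / (z - w)\<^sup>2)" for w
  proof (cases "cmod w < 1")
    case True
    have "(\<lambda>j. (\<mu> w / z\<^sup>2) * (of_nat (Suc j) * (w / z) ^ j)) sums ((\<mu> w / z\<^sup>2) * (1 / (1 - w / z)\<^sup>2))"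
      using True z z0 by (intro sums_mult geometric_deriv_sums) (simp add: norm_divide divide_less_eq)
    also have "(\<mu> w / z\<^sup>2) * (1 / (1 - w / z)\<^sup>2) = \<mu> w / (z - w)\<^sup>2"
      using z0 by (simp add: power_divide[symmetric] diff_divide_distrib flip: power_mult_distrib) (simp add: right_diff_distrib)
    finally show ?thesis
      by (simp add: f_def power_divide power_add power2_eq_square mult_ac)
  next
    case False
    then have "\<mu> w = 0" using \<mu>_le[of w] by simp
    then show ?thesis by (simp add: f_def)
  qed
  have "(\<lambda>j. LINT w|lborel. f j w) sums (LINT w|lborel. (\<Sum>j. f j w))"
  proof (rule sums_integral)
    show "integrable lborel (f j)" for j
      unfolding f_def by (intro integrable_mult_right integrable_\<mu>_power)
    show "AE w in lborel. summable (\<lambda>j. norm (f j w))"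
    proof (rule AE_I2)
      fix w
      show "summable (\<lambda>j. norm (f j w))"
      proof (cases "cmod w < 1")
        case True
        then have "summable (\<lambda>j. of_nat (Suc j) * (cmod w / cmod z) ^ j)"
          using z by (intro sums_summable[OF geometric_deriv_sums]) (simp add: divide_less_eq)
        then have "summable (\<lambda>j. (cmod (\<mu> w) / cmod z ^ 2) * (of_nat (Suc j) * (cmod w / cmod z) ^ j))"
          by (rule summable_mult)
        then show ?thesis
          by (simp add: f_def norm_mult norm_divide norm_power power_divide power_add power2_eq_square mult_ac del: of_nat_Suc)
      next
        case False
        then have "\<mu> w = 0" using \<mu>_le[of w] by simp
        then show ?thesis by (simp add: f_def)
      qed
    qed
    show "summable (\<lambda>j. LINT w|lborel. norm (f j w))"
    proof (rule summable_comparison_test')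
      have "(\<lambda>j. real (Suc j) * (1 / cmod z) ^ j) sums (1 / (1 - 1 / cmod z)\<^sup>2)"
        using z by (intro geometric_deriv_sums) (simp add: divide_less_eq)
      then show "summable (\<lambda>j. real (Suc j) * (1 / cmod z) ^ j * (pi / cmod z ^ 2))"
        by (intro summable_mult2) (rule sums_summable)
      show "norm (LINT w|lborel. norm (f j w)) \<le> real (Suc j) * (1 / cmod z) ^ j * (pi / cmod z ^ 2)" for j
      proof -
        have "(LINT w|lborel. norm (f j w)) = real (Suc j) / cmod z ^ (j + 2) * (LINT w|lborel. cmod (\<mu> w * w ^ j))"
          by (simp only: f_def norm_mult[of "_ / _"] norm_divide norm_of_nat norm_power integral_mult_right_zero)
        also have "\<dots> \<le> real (Suc j) / cmod z ^ (j + 2) * pi"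
          by (intro mult_left_mono integral_norm_\<mu>_power_le) auto
        finally show ?thesis
          by (simp add: power_add power_divide power2_eq_square mult_ac del: of_nat_Suc)
      qed
    qed
  qed
  then have "(\<lambda>j. - (1 / of_real pi) * (LINT w|lborel. f j w)) sums (- (1 / of_real pi) * (LINT w|lborel. \<mu> w / (z - w)\<^sup>2))"
    using f_sums by (intro sums_mult) (simp add: sums_iff)
  moreover have "- (1 / of_real pi) * (LINT w|lborel. f j w) = beurling_coeff \<mu> j / z ^ (j + 2)" for j
    by (simp add: f_def beurling_coeff_def)
  ultimately show ?thesis
    by (simp add: beurling_eq_integral[OF z])
qed

text \<open>On the circle of radius \<open>R\<close> the expansion at infinity is an absolutely
  convergent Fourier series with the distinct frequencies -(j+2), so Parseval applies.\<close>

lemma circle_integral_beurling_ge: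
  assumes R: "R > 1" and "finite F"
  shows "2 * pi * (\<Sum>j\<in>F. (cmod (beurling_coeff \<mu> j) / R ^ (j + 2))\<^sup>2) \<le>
    (LINT t:{0..2*pi}|lborel. (cmod (beurling \<mu> (of_real R * cis t)))\<^sup>2)"
proof -
  have "beurling \<mu> (of_real R * cis t)
      = (\<Sum>j. (beurling_coeff \<mu> j / of_real (R ^ (j + 2))) * cis (of_int (- int (j + 2)) * t))" for t
  proof -
    have "(of_real R * cis t) ^ n = of_real (R ^ n) / cis (of_int (- int n) * t)" for n
      by (simp add: power_mult_distrib Complex.DeMoivre field_simps cis_mult)
    then have "(\<lambda>j. (beurling_coeff \<mu> j / of_real (R ^ (j + 2))) * cis (of_int (- int (j + 2)) * t)) sums beurling \<mu> (of_real R * cis t)"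
      using beurling_sums[of "of_real R * cis t"] R by (simp add: norm_mult del: power_Suc power_add of_int_minus of_nat_add)
    then show ?thesis by (simp only: sums_iff)
  qed
  moreover have "inj (\<lambda>j. - int (j + 2))" by (auto simp: inj_def)
  ultimately show ?thesis
    using parseval_sum_le[OF _ summable_beurling_coeff[OF R] \<open>finite F\<close>, of "\<lambda>j. - int (j + 2)"] R
    by (simp only: norm_divide norm_power norm_of_real abs_of_pos zero_less_power)
qed

end

section \<open>The lacunary dilatation\<close>

text \<open>A limsup can be bounded below along one sequence: the image filter of \<open>R\<close>
  is finer than \<open>at_right a\<close>, and a finer filter has a smaller limsup.\<close>

lemma Limsup_at_right_ge:
  fixes F :: "real \<Rightarrow> ereal"
  assumes R: "filterlim R (at_right a) sequentially" and g: "eventually (\<lambda>k::nat. ereal (g k) \<le> F (R k)) sequentially"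
    and lim: "g \<longlonglongrightarrow> l"
  shows "ereal l \<le> Limsup (at_right a) F"
proof -
  have "ereal l = Limsup sequentially (\<lambda>k. ereal (g k))"
    using lim by (intro lim_imp_Limsup[symmetric]) auto
  also have "\<dots> \<le> Limsup sequentially (\<lambda>k. F (R k))"
    using g by (rule Limsup_mono)
  also have "\<dots> \<le> Limsup (filtermap R sequentially) F"
    by (rule Limsup_filtermap_ge)
  also have "\<dots> \<le> Limsup (at_right a) F"
    using R unfolding Limsup_def filterlim_def le_filter_def
    by (intro INF_superset_mono) auto
  finally show ?thesis .
qed
text \<open>The quotient that arises at radius 1 + 1/(k d^k) with \<open>L = ln d\<close>: the
  denominator is |ln(R - 1)|, and ln k, the factor exp(-2/k) and the loss of 1 are of lower
  order.\<close>

lemma tendsto_variance_bound: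
  fixes c :: real
  assumes "L > 0"
  shows "(\<lambda>k. c * exp (- 2 / real k) * (real k - 1) / (real k * L + ln (real k))) \<longlonglongrightarrow> c / L"
  using assms by (real_asymp simp: divide_inverse)

text \<open>The bound \<open>d \<ge> 3\<close> makes every exponent \<open>d ^ Suc n - 2\<close>
  positive and keeps the sum of 2/d^(n+1) at most 1.\<close>

locale lacunary_dilatation =
  fixes d :: nat and \<beta> :: real
  assumes d: "d \<ge> 3" and \<beta>: "0 < \<beta>" "\<beta> < 1"
begin

definition radius :: "nat \<Rightarrow> real" where
  "radius n = \<beta> powr (1 / real d ^ n)"

definition annulus :: "nat \<Rightarrow> complex set" where
  "annulus n = {w. radius n \<le> cmod w \<and> cmod w < radius (Suc n)}"

text \<open>The annuli are disjoint, so at most one term of the series is nonzero; written as a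
  series, the function is visibly Borel. The exponent is N - 2 because the coefficient of z^-N is a
  moment against w^(N-2).\<close>

definition dilatation :: "complex \<Rightarrow> complex" where
  "dilatation w = (\<Sum>n. indicator (annulus n) w *\<^sub>R (cnj w / cmod w) ^ (d ^ Suc n - 2))"

section \<open>The radii, the annuli and the pointwise size of the dilatation\<close>

lemma radius_pos: "radius n > 0"
  using \<beta> by (simp add: radius_def)

lemma radius_less_1: "radius n < 1"
  using \<beta> d powr_less_mono'[of \<beta> 0 "1 / real d ^ n"] by (simp add: radius_def)

lemma strict_mono_radius: "strict_mono radius"
proof (rule strict_monoI_Suc)
  fix n
  have "real d ^ n < real d ^ Suc n"
    using d by (intro power_strict_increasing) auto
  then have "1 / real d ^ Suc n < 1 / real d ^ n"
    using d by (intro divide_strict_left_mono) auto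
  then show "radius n < radius (Suc n)"
    using \<beta> powr_less_mono'[of \<beta> "1 / real d ^ Suc n" "1 / real d ^ n"]
    by (simp add: radius_def)
qed

text \<open>The reason for the choice of radii: both powers are independent of n, so all annuli
  contribute equally up to the factor 1 - 1/N.\<close>

lemma radius_power: "radius n ^ (d ^ n) = \<beta>" "radius n ^ (d ^ Suc n) = \<beta> ^ d"
proof -
  show 1: "radius n ^ (d ^ n) = \<beta>"
    using \<beta> d by (simp add: radius_def powr_power)
  show "radius n ^ (d ^ Suc n) = \<beta> ^ d"
    by (simp add: power_mult 1 mult.commute[of d])
qed

lemma annulus_disjoint: "i \<noteq> j \<Longrightarrow> annulus i \<inter> annulus j = {}"
proof (induction i j rule: linorder_wlog)
  case (le i j)
  then have "radius (Suc i) \<le> radius j"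
    using strict_mono_less_eq[OF strict_mono_radius] by simp
  then show ?case by (auto simp: annulus_def)
qed auto

lemma dilatation_on_annulus:
  assumes "w \<in> annulus n"
  shows "dilatation w = (cnj w / cmod w) ^ (d ^ Suc n - 2)"
proof -
  have "indicator (annulus m) w *\<^sub>R (cnj w / cmod w) ^ (d ^ Suc m - 2) = 0" if "m \<notin> {n}" for m
    using that assms annulus_disjoint[of m n] by (auto simp: indicator_def)
  then have "dilatation w = (\<Sum>m\<in>{n}. indicator (annulus m) w *\<^sub>R (cnj w / cmod w) ^ (d ^ Suc m - 2))"
    unfolding dilatation_def by (intro suminf_finite) auto
  then show ?thesis using assms by simp
qed

lemma dilatation_outside: "w \<notin> (\<Union>n. annulus n) \<Longrightarrow> dilatation w = 0"
  by (simp add: dilatation_def)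

lemma annulus_subset_ball: "annulus n \<subseteq> ball 0 1"
  using radius_less_1[of "Suc n"] by (auto simp: annulus_def)

lemma sets_annulus [measurable]: "annulus n \<in> sets borel"
  unfolding annulus_def by measurable

lemma dilatation_measurable [measurable]: "dilatation \<in> borel_measurable borel"
  unfolding dilatation_def by measurable

lemma cmod_dilatation_le: "cmod (dilatation w) \<le> indicator (ball 0 1) w"
proof (cases "w \<in> (\<Union>n. annulus n)")
  case True
  then obtain n where n: "w \<in> annulus n" by auto
  then have "w \<noteq> 0" using radius_pos[of n] by (auto simp: annulus_def)
  then show ?thesis
    using n annulus_subset_ball[of n] by (auto simp: dilatation_on_annulus norm_power norm_divide)
qed (simp add: dilatation_outside)

text \<open>Split the integral over the annuli. On annulus k the angular exponent is
  \<open>q k\<close>, so by \<open>annulus_moment\<close> only k = n survives.\<close>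

lemma moment_dilatation:
  "(LINT w|lborel. dilatation w * w ^ (d ^ Suc n - 2)) = of_real (2 * pi * (\<beta> - \<beta> ^ d) / d ^ Suc n)"
proof -
  define q where "q k = d ^ Suc k - 2" for k
  \<comment> \<open>Makes the natural-number subtraction in \<open>q\<close> exact and its result
    positive.\<close>
  have ge: "d ^ Suc k \<ge> 3" for k
    using d self_le_power[of d "Suc k"] by linarith
  have q_add: "q k + 2 = d ^ Suc k" for k
    using ge[of k] unfolding q_def by linarith
  have q_pos: "q k > 0" for k
    using ge[of k] unfolding q_def by linarith
  have q_eq: "q k = q n \<longleftrightarrow> k = n" for k
  proof
    assume "q k = q n"
    then have "d ^ Suc k = d ^ Suc n" by (simp only: q_add[symmetric])
    then show "k = n" using d power_inject_exp[of d "Suc k" "Suc n"] by simp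
  qed simp
  have "(LINT w|lborel. dilatation w * w ^ q n) = (LINT w:(\<Union>k. annulus k)|lborel. dilatation w * w ^ q n)"
    unfolding set_lebesgue_integral_def
    by (intro Bochner_Integration.integral_cong refl) (auto simp: indicator_def dilatation_outside)
  also have "\<dots> = (\<Sum>k. LINT w:annulus k|lborel. dilatation w * w ^ q n)"
  proof (rule lebesgue_integral_countable_add)
    show "set_integrable lborel (\<Union>k. annulus k) (\<lambda>w. dilatation w * w ^ q n)"
      unfolding set_integrable_def
      by (intro integrable_mult_indicator integrable_\<mu>_power cmod_dilatation_le) auto
  qed (use annulus_disjoint in auto)
  also have "(\<lambda>k. LINT w:annulus k|lborel. dilatation w * w ^ q n)
      = (\<lambda>k. if k = n then of_real (2 * pi * (\<beta> - \<beta> ^ d) / d ^ Suc n) else 0)"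
  proof
    fix k
    have "(LINT w:annulus k|lborel. dilatation w * w ^ q n) = (LINT w:annulus k|lborel. (cnj w / cmod w) ^ q k * w ^ q n)"
      by (intro set_lebesgue_integral_cong) (auto simp: dilatation_on_annulus q_def)
    also have "\<dots> = (if q k = q n then of_real (2 * pi * (radius (Suc k) ^ (q n + 2) - radius k ^ (q n + 2)) / (q n + 2)) else 0)"
      unfolding annulus_def using radius_pos[of k] strict_mono_radius q_pos[of n]
      by (intro annulus_moment) (auto simp: strict_mono_def less_imp_le)
    also have "\<dots> = (if k = n then of_real (2 * pi * (\<beta> - \<beta> ^ d) / d ^ Suc n) else 0)"
      by (simp only: q_eq q_add radius_power cong: if_cong)
    finally show "(LINT w:annulus k|lborel. dilatation w * w ^ q n) = (if k = n then of_real (2 * pi * (\<beta> - \<beta> ^ d) / d ^ Suc n) else 0)" .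
  qed
  also have "(\<Sum>k. if k = n then of_real (2 * pi * (\<beta> - \<beta> ^ d) / d ^ Suc n) else 0) = (of_real (2 * pi * (\<beta> - \<beta> ^ d) / d ^ Suc n) :: complex)"
    using sums_single[of n "\<lambda>_. of_real (2 * pi * (\<beta> - \<beta> ^ d) / d ^ Suc n) :: complex"] by (simp only: sums_iff)
  finally show ?thesis by (simp only: q_def)
qed

lemma norm_beurling_coeff_dilatation:
  "cmod (beurling_coeff dilatation (d ^ Suc n - 2)) = 2 * (\<beta> - \<beta> ^ d) * (1 - 1 / real d ^ Suc n)"
proof -
  have ge: "d ^ Suc n \<ge> 3"
    using d self_le_power[of d "Suc n"] by linarith
  then have S: "real (Suc (d ^ Suc n - 2)) = real d ^ Suc n - 1"
    by (simp add: of_nat_diff del: power_Suc)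
  have "real (d ^ Suc n) > 1" using ge by linarith
  then have g1: "real d ^ Suc n > 1" by (simp del: power_Suc)
  have le: "\<beta> ^ d \<le> \<beta>"
    using \<beta> d power_decreasing[of 1 d \<beta>] by simp
  have *: "(x - 1) / pi * (2 * pi * h / x) = 2 * h * (1 - 1 / x)" if "x > 1" for x h :: real
    using that by (simp add: field_simps)
  have "cmod (beurling_coeff dilatation (d ^ Suc n - 2))
      = (real d ^ Suc n - 1) / pi * (2 * pi * (\<beta> - \<beta> ^ d) / real d ^ Suc n)"
    unfolding beurling_coeff_def moment_dilatation S
    using g1 le by (simp add: norm_mult norm_divide abs_mult norm_power del: of_real_diff of_real_power power_Suc flip: of_real_power)
  also have "\<dots> = 2 * (\<beta> - \<beta> ^ d) * (1 - 1 / real d ^ Suc n)"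
    using * g1 by blast
  finally show ?thesis .
qed

text \<open>Bounds by 1 the total loss from the factors (1 - 1/N)^2. The sharper right-hand side
  carries the induction, whose step is 3/d^(k+1) \<le> 1/d^k.\<close>

lemma sum_inverse_powers_le: "(\<Sum>n<k. 2 / real d ^ Suc n) \<le> 1 - 1 / real d ^ k"
proof (induction k)
  case (Suc k)
  have "(\<Sum>n<Suc k. 2 / real d ^ Suc n) \<le> 1 - 1 / real d ^ k + 2 / real d ^ Suc k"
    using Suc.IH by simp
  also have "\<dots> \<le> 1 - 1 / real d ^ Suc k"
    using d by (simp add: field_simps)
  finally show ?case .
qed simp

text \<open>The radius is chosen so that the first k frequencies N \<le> d^k are hardly damped: R^N
  \<le> exp(N/(k d^k)) \<le> exp(1/k). The extra k in the denominator makes this damping disappear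
  in the limit.\<close>

lemma circle_integral_dilatation_ge:
  assumes k: "k \<ge> 1" and R: "R = 1 + 1 / (real k * real d ^ k)"
  shows "2 * pi * (4 * (\<beta> - \<beta> ^ d)\<^sup>2 * exp (- 2 / real k) * (real k - 1))
    \<le> (LINT t:{0..2*pi}|lborel. (cmod (beurling dilatation (of_real R * cis t)))\<^sup>2)"
proof -
  define h where "h = \<beta> - \<beta> ^ d"
  define q where "q n = d ^ Suc n - 2" for n
  have ge: "d ^ Suc n \<ge> 3" for n
    using d self_le_power[of d "Suc n"] by linarith
  have q_add: "q n + 2 = d ^ Suc n" for n
    using ge[of n] unfolding q_def by linarith
  have inj: "inj q"
  proof (rule injI)
    fix i j assume "q i = q j"
    then have "d ^ Suc i = d ^ Suc j" by (simp only: q_add[symmetric])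
    then show "i = j" using d power_inject_exp[of d "Suc i" "Suc j"] by simp
  qed
  have R1: "R > 1" using k d by (simp add: R)
  have term_ge: "4 * h\<^sup>2 * exp (- 2 / real k) * (1 - 2 / real d ^ Suc n)
      \<le> (cmod (beurling_coeff dilatation (q n)) / R ^ (q n + 2))\<^sup>2" if "n < k" for n
  proof -
    define x where "x = 1 / real d ^ Suc n"
    have le: "real d ^ Suc n \<le> real d ^ k"
      using that d by (intro power_increasing) auto
    have "R ^ (q n + 2) \<le> exp (1 / (real k * real d ^ k)) ^ (q n + 2)"
      using R1 by (intro power_mono) (auto simp: R exp_ge_add_one_self)
    also have "\<dots> = exp (real d ^ Suc n / (real k * real d ^ k))"
      by (simp only: q_add exp_of_nat_mult[symmetric]) simp
    also have "\<dots> \<le> exp (1 / real k)"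
      using le k d by (simp add: field_simps)
    finally have "R ^ (q n + 2) \<le> exp (1 / real k)" .
    then have "(R ^ (q n + 2))\<^sup>2 \<le> exp (1 / real k) ^ 2"
      using R1 by (intro power_mono) auto
    also have "\<dots> = exp (2 / real k)"
      by (simp flip: exp_of_nat_mult)
    finally have R2: "(R ^ (q n + 2))\<^sup>2 \<le> exp (2 / real k)" .
    \<comment> \<open>Linearizes the factor (1 - 1/N)^2, so that the losses add up to a geometric
      sum.\<close>
    have "(1 - 2 * x) \<le> (1 - x)\<^sup>2" by (simp add: power2_eq_square algebra_simps)
    then have "4 * h\<^sup>2 * exp (- 2 / real k) * (1 - 2 * x) \<le> 4 * h\<^sup>2 * exp (- 2 / real k) * (1 - x)\<^sup>2"
      by (intro mult_left_mono) auto
    also have "\<dots> = (2 * h * (1 - x))\<^sup>2 / exp (2 / real k)"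
      unfolding power_mult_distrib by (simp add: exp_minus divide_inverse mult_ac)
    also have "\<dots> \<le> (2 * h * (1 - x))\<^sup>2 / (R ^ (q n + 2))\<^sup>2"
      using R2 R1 by (intro divide_left_mono) auto
    also have "\<dots> = (cmod (beurling_coeff dilatation (q n)) / R ^ (q n + 2))\<^sup>2"
      by (simp only: q_def norm_beurling_coeff_dilatation h_def x_def power_divide)
    finally show ?thesis by (simp add: x_def)
  qed
  have "4 * h\<^sup>2 * exp (- 2 / real k) * (real k - 1) \<le> 4 * h\<^sup>2 * exp (- 2 / real k) * (\<Sum>n<k. 1 - 2 / real d ^ Suc n)"
  proof (intro mult_left_mono)
    have "(\<Sum>n<k. 2 / real d ^ Suc n) \<le> 1"
      using sum_inverse_powers_le[of k] by (rule order_trans) simp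
    then show "real k - 1 \<le> (\<Sum>n<k. 1 - 2 / real d ^ Suc n)"
      by (simp add: sum_subtractf)
  qed auto
  also have "\<dots> \<le> (\<Sum>n<k. (cmod (beurling_coeff dilatation (q n)) / R ^ (q n + 2))\<^sup>2)"
    unfolding sum_distrib_left by (intro sum_mono term_ge) auto
  also have "\<dots> = (\<Sum>j\<in>q ` {..<k}. (cmod (beurling_coeff dilatation j) / R ^ (j + 2))\<^sup>2)"
    using inj by (subst sum.reindex) (auto intro: inj_on_subset)
  finally have "2 * pi * (4 * h\<^sup>2 * exp (- 2 / real k) * (real k - 1))
     \<le> 2 * pi * (\<Sum>j\<in>q ` {..<k}. (cmod (beurling_coeff dilatation j) / R ^ (j + 2))\<^sup>2)"
    by (intro mult_left_mono) auto
  also have "\<dots> \<le> (LINT t:{0..2*pi}|lborel. (cmod (beurling dilatation (of_real R * cis t)))\<^sup>2)"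
    by (intro circle_integral_beurling_ge cmod_dilatation_le R1) auto
  finally show ?thesis by (simp add: h_def)
qed

text \<open>Evaluate along the radii \<open>R k\<close>: the circle integral grows like 2 pi C k and
  |ln(R k - 1)| like k ln d, so the quotient tends to 2 pi C / ln d. The normalization 1/(2 pi) then
  cancels 2 pi.\<close>

lemma asymp_var_dilatation_ge:
  "ereal (4 * (\<beta> - \<beta> ^ d)\<^sup>2 / ln (real d)) \<le> asymp_var (beurling dilatation)"
proof -
  define C where "C = 4 * (\<beta> - \<beta> ^ d)\<^sup>2"
  define R where "R k = 1 + 1 / (real k * real d ^ k)" for k
  define I where "I r = (LINT t:{0..2*pi}|lborel. (cmod (beurling dilatation (of_real r * cis t)))\<^sup>2)" for r
  define g where "g k = 2 * pi * (C * exp (- 2 / real k) * (real k - 1) / (real k * ln (real d) + ln (real k)))" for k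
  have lnd: "ln (real d) > 0" using d by simp
  have R_lim: "filterlim R (at_right 1) sequentially"
  proof -
    have "(\<lambda>k. 1 + 1 / real k * (1 / real d) ^ k) \<longlonglongrightarrow> 1 + 0 * 0"
      using d by (intro tendsto_intros LIMSEQ_power_zero lim_1_over_n) auto
    then have "R \<longlonglongrightarrow> 1" by (simp add: R_def[abs_def] power_divide)
    moreover have "eventually (\<lambda>k. R k \<in> {1<..}) sequentially"
      using eventually_gt_at_top[of 0] by eventually_elim (use d in \<open>simp add: R_def\<close>)
    ultimately show ?thesis by (simp add: filterlim_at eventually_mono)
  qed
  have "ereal (2 * pi * (C / ln (real d))) \<le> Limsup (at_right 1) (\<lambda>r. ereal (1 / \<bar>ln (r - 1)\<bar> * I r))"
  proof (rule Limsup_at_right_ge[OF R_lim])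
    show "\<forall>\<^sub>F k in sequentially. ereal (g k) \<le> ereal (1 / \<bar>ln (R k - 1)\<bar> * I (R k))"
      using eventually_ge_at_top[of 1]
    proof eventually_elim
      case (elim k)
      have "ln (R k - 1) = - (real k * ln (real d) + ln (real k))"
        using elim d by (simp add: R_def ln_div ln_mult ln_realpow)
      moreover have "2 * pi * (C * exp (- 2 / real k) * (real k - 1)) \<le> I (R k)"
        unfolding I_def C_def using elim by (intro circle_integral_dilatation_ge) (auto simp: R_def)
      moreover have "0 < real k * ln (real d) + ln (real k)"
        using elim lnd by (intro add_pos_nonneg mult_pos_pos) auto
      ultimately show ?case by (simp add: g_def divide_right_mono abs_of_neg add_ac)
    qed
    show "g \<longlonglongrightarrow> 2 * pi * (C / ln (real d))"
      unfolding g_def by (intro tendsto_intros tendsto_variance_bound lnd)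
  qed
  then have "ereal (1 / (2 * pi)) * ereal (2 * pi * (C / ln (real d))) \<le> asymp_var (beurling dilatation)"
    unfolding asymp_var_def I_def by (intro ereal_mult_left_mono) auto
  then show ?thesis by (simp add: C_def)
qed

end

section \<open>Numerical evaluation for d = 20 and conclusion\<close>

lemma variance_bound_20:
  "4 * ((8541/10000) - (8541/10000)^20)^2 / ln 20 > (87913/100000 :: real)"
proof -
  \<comment> \<open>The margin in the final inequality is only of order 10^-6, so ln 20 must be
    known precisely. Writing 20 = 2^4 (5/4) leaves logarithms of numbers near 1, for which a short
    truncation of the series suffices.\<close>
  have "ln (5/4) \<le> (22314356/100000000 :: real)"
    using ln_approx_bounds[of "5/4::real" 4] by (simp add: eval_nat_numeral)
  moreover have "ln 2 \<le> (69314719/100000000 :: real)"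
    using ln_approx_bounds[of "2::real" 8] by (simp add: eval_nat_numeral)
  moreover have "ln 20 = 4 * ln 2 + ln (5/4 :: real)"
  proof -
    have "ln (20::real) = ln (2 ^ 4 * (5/4))" by simp
    also have "\<dots> = 4 * ln 2 + ln (5/4)" by (subst ln_mult) (simp_all add: ln_realpow del: power_numeral)
    finally show ?thesis .
  qed
  ultimately have "ln 20 \<le> (299573232/100000000 :: real)" by simp
  moreover have "ln 20 > (0::real)" by simp
  moreover have "4 * ((8541/10000) - (8541/10000)^20)^2 > (87913/100000) * (299573232/100000000 :: real)"
    by (simp add: power_divide)
  ultimately show ?thesis by (simp add: pos_less_divide_eq)
qed

theorem theorem1p2:
  shows "\<exists>\<mu> :: complex \<Rightarrow> complex.
           \<mu> \<in> borel_measurable lebesgue \<and>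
           (\<forall>z. cmod (\<mu> z) \<le> indicator (ball 0 1) z) \<and>
           asymp_var (beurling \<mu>) > ereal 0.87913"
proof -
  \<comment> \<open>Here 8541/10000 is 20^(-1/19) rounded to four decimals; the exact value
    maximizes \<beta> - \<beta>^20.\<close>
  interpret lacunary_dilatation 20 "8541 / 10000"
    by unfold_locales auto
  have "ereal 0.87913 < ereal (4 * (8541 / 10000 - (8541 / 10000) ^ 20)\<^sup>2 / ln (real 20))"
    using variance_bound_20 by simp
  also have "\<dots> \<le> asymp_var (beurling dilatation)"
    by (rule asymp_var_dilatation_ge)
  finally show ?thesis
    using cmod_dilatation_le dilatation_measurable
    by (intro exI[of _ dilatation]) (auto intro: measurable_completion)
qed

end
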